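(* Let $\Sigma$ be a finite non-empty alphabet and let $L\subseteq\Sigma^*$ be a regular language with exactly $n$ distinct left quotients $K_0,\dots,K_{n-1}$; put $Q=\{0,\dots,n-1\}$. Suppose that $L$ has maximal syntactic complexity, that is, its syntactic semigroup has cardinality $n^n$. Then $L$ has $2^n$ atoms, and each atom has maximal quotient complexity: for each atom $A_S$ ($S\subseteq Q$), with $r=|Q\setminus S|$ the number of complemented quotients, the number of distinct left quotients of the language $A_S$ equals \[ \begin{cases} 2^n-1, & \text{if } r=0 \text{ or } r=n,\\[4pt] 1+\displaystyle\sum_{k=1}^{r}\ \sum_{h=k+1}^{k+n-r}\binom{n}{h}\binom{h}{k}, & \text{if } 1\le r\le n-1. \end{cases} \]
   Context: The left quotient of a language $L\subseteq\Sigma^*$ by a word $w\in\Sigma^*$ is $w^{-1}L=\{x\in\Sigma^*\mid wx\in L\}$. The quotient complexity of a regular language is its number of distinct left quotients (equivalently, the number of states of its minimal complete DFA). The syntactic semigroup of $L$ is $\Sigma^+/\!\approx_L$, where $x\approx_L y$ iff for all $u,v\in\Sigma^*$: $uxv\in L\Leftrightarrow uyv\in L$. It is isomorphic to the semigroup of transformations of the state set of the minimal DFA of $L$ induced by non-empty words. The syntactic complexity of $L$ is the cardinality of this semigroup; for a language with $n$ quotients it is at most $n^n$. For $S\subseteq Q$ define $A_S=\left(\bigcap_{i\in S}K_i\right)\cap\left(\bigcap_{j\in Q\setminus S}\overline{K_j}\right)$, where $\overline{K_j}=\Sigma^*\setminus K_j$. An atom of $L$ is a non-empty language of the form $A_S$;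 thus a language with $n$ quotients has at most $2^n$ atoms.
   Formalization: The claim that L has 2^n atoms is stated only for n ≥ 2: for n = 1 the language is empty or Σ*, its syntactic semigroup has 1 = 1^1 element, but it has one atom rather than 2; the quotient complexity formula is kept for all n. *)

theory Defs
  imports Complex_Main
begin

text \<open>The alphabet is the finite (hence non-empty) type \<open>'a\<close>; words are lists and
  \<open>\<Sigma>\<^sup>*\<close> is \<open>UNIV\<close>.\<close>

text \<open>Taking the states to be an initial segment of the naturals avoids quantifying over a
  type of states. Acceptance by a complete deterministic automaton:\<close>

definition regular_language :: "'a::finite list set \<Rightarrow> bool" where
  "regular_language L \<longleftrightarrow>
     (\<exists>(m::nat) (\<delta> :: nat \<Rightarrow> 'a \<Rightarrow> nat) q0 F.
        q0 < m \<and> (\<forall>q<m. \<forall>a. \<delta> q a < m) \<and> F \<subseteq> {..<m} \<and>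
        L = {w. foldl \<delta> q0 w \<in> F})"

definition left_quotient :: "'a list \<Rightarrow> 'a list set \<Rightarrow> 'a list set" where
  "left_quotient w L = {x. w @ x \<in> L}"

definition left_quotients :: "'a list set \<Rightarrow> 'a list set set" where
  "left_quotients L = range (\<lambda>w. left_quotient w L)"

definition quotient_complexity :: "'a list set \<Rightarrow> nat" where
  "quotient_complexity L = card (left_quotients L)"

definition syntactic_congruence :: "'a list set \<Rightarrow> ('a list \<times> 'a list) set" where
  "syntactic_congruence L =
     {(x, y). x \<noteq> [] \<and> y \<noteq> [] \<and> (\<forall>u v. u @ x @ v \<in> L \<longleftrightarrow> u @ y @ v \<in> L)}"

text \<open>Carrier of the syntactic semigroup; only its cardinality is needed.\<close>

definition syntactic_semigroup :: "'a list set \<Rightarrow> 'a list set set" where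
  "syntactic_semigroup L = {w. w \<noteq> []} // syntactic_congruence L"

definition syntactic_complexity :: "'a list set \<Rightarrow> nat" where
  "syntactic_complexity L = card (syntactic_semigroup L)"

text \<open>\<open>K 0, \<dots>, K (n - 1)\<close> is an enumeration of the left quotients of a language. An
  intersection over the empty index set is \<open>\<Sigma>\<^sup>*\<close>.\<close>

definition atomic_intersection :: "(nat \<Rightarrow> 'a list set) \<Rightarrow> nat \<Rightarrow> nat set \<Rightarrow> 'a list set" where
  "atomic_intersection K n S = (\<Inter>i\<in>S. K i) \<inter> (\<Inter>j\<in>{..<n} - S. - K j)"

text \<open>For \<open>n = 1\<close> the only quotient is \<open>{}\<close> or \<open>\<Sigma>\<^sup>*\<close>, so just one of the two
  intersections is non-empty and there is one atom rather than \<open>2 ^ n\<close>.\<close>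

definition atoms :: "(nat \<Rightarrow> 'a list set) \<Rightarrow> nat \<Rightarrow> 'a list set set" where
  "atoms K n = {atomic_intersection K n S | S. S \<subseteq> {..<n} \<and> atomic_intersection K n S \<noteq> {}}"

end

theory Submission
  imports Defs "HOL-Library.FuncSet"
begin

text \<open>Words act on the quotients by \<open>K i \<mapsto> w\<^sup>-\<^sup>1 (K i)\<close>, and this action factors
  through the syntactic semigroup; cardinality \<open>n ^ n\<close> forces every transformation of the \<open>n\<close>
  quotients to be induced by a non-empty word. If \<open>n \<ge> 2\<close>, some quotient contains the empty word
  and some quotient does not, so every subset \<open>P\<close> of the indices is the set of indices of the
  quotients that contain some suitable word. Hence all \<open>2 ^ n\<close> atoms are non-empty.

  A quotient of an atom \<open>A\<^sub>S\<close> consists of the words that lie in \<open>K i\<close> for all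
  \<open>i \<in> g ` S\<close> and in no \<open>K j\<close> with \<open>j \<in> g ` (Q - S)\<close>, for a transformation \<open>g\<close>, and all \<open>g\<close>
  occur. It is empty when the two images meet, and otherwise it determines both images. So one
  counts the pairs of disjoint non-empty sets \<open>X\<close>, \<open>Y\<close> with \<open>card X \<le> card S\<close> and
  \<open>card Y \<le> card (Q - S)\<close>, by \<open>h = card (X \<union> Y)\<close> and \<open>k = card Y\<close>;
  if \<open>S\<close> is empty or all of \<open>Q\<close>, one image is empty and the other is any non-empty set.\<close>

section \<open>Maps with prescribed images, and counting pairs of disjoint sets\<close>

lemma ex_image_eq_if_card_le:
  assumes "finite A" "finite B" "B \<noteq> {}" "card B \<le> card A"
  shows "\<exists>g. g ` A = B"
  using inj_on_iff_surj[OF assms(3), of A] inj_on_iff_card_le[OF assms(2,1)] assms(4) by blast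

text \<open>A surjection from \<open>S\<close> onto \<open>X\<close> and one from
  \<open>N - S\<close> onto \<open>Y\<close> are glued; their domains are disjoint, so the two size
  bounds can be met independently.\<close>

lemma ex_map_with_two_images:
  assumes "finite N" "S \<subseteq> N"
    and X: "X \<subseteq> N" "X \<noteq> {}" "card X \<le> card S"
    and Y: "Y \<subseteq> N" "Y \<noteq> {}" "card Y \<le> card (N - S)"
  shows "\<exists>g\<in>N \<rightarrow> N. g ` S = X \<and> g ` (N - S) = Y"
proof -
  have "finite S" "finite X" "finite Y"
    using assms by (auto intro: finite_subset)
  then obtain g1 g2 where g: "g1 ` S = X" "g2 ` (N - S) = Y"
    using ex_image_eq_if_card_le[of S X] ex_image_eq_if_card_le[of "N - S" Y] assms by auto
  define g where "g = (\<lambda>i. if i \<in> S then g1 i else g2 i)"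
  have "g ` S = X" "g ` (N - S) = Y"
    unfolding g(1)[symmetric] g(2)[symmetric] by (auto simp: g_def)
  moreover have "g \<in> N \<rightarrow> N"
    using g X(1) Y(1) by (auto simp: g_def image_subset_iff)
  ultimately show ?thesis by blast
qed

definition bounded_disjoint_pairs :: "'b set \<Rightarrow> nat \<Rightarrow> nat \<Rightarrow> ('b set \<times> 'b set) set" where
  "bounded_disjoint_pairs N s r =
     {(X, Y). X \<subseteq> N \<and> Y \<subseteq> N \<and> X \<inter> Y = {} \<and> X \<noteq> {} \<and> Y \<noteq> {} \<and> card X \<le> s \<and> card Y \<le> r}"

text \<open>First choose the union \<open>H\<close> of size \<open>h\<close>, then \<open>Y\<close>
  of size \<open>k\<close> inside it; this leaves \<open>X = H - Y\<close>. The range of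
  \<open>h\<close> says that \<open>X\<close> has between 1 and \<open>s\<close> elements.\<close>

lemma card_bounded_disjoint_pairs:
  assumes "finite N"
  shows "card (bounded_disjoint_pairs N s r) =
    (\<Sum>k=1..r. \<Sum>h=k+1..k+s. (card N choose h) * (h choose k))"
proof -
  \<comment> \<open>The sizes \<open>k\<close> and \<open>h\<close> are carried along as components,
    so that the cardinality of the nested \<open>SIGMA\<close> unfolds into the double sum.\<close>
  define B where "B = (SIGMA k:{1..r}. SIGMA h:{k+1..k+s}.
    SIGMA H:{H. H \<subseteq> N \<and> card H = h}. {Y. Y \<subseteq> H \<and> card Y = k})"
  have fin: "finite H" if "H \<subseteq> N" for H
    using that assms finite_subset by blast
  have "bij_betw (\<lambda>(X, Y). (card Y, card (X \<union> Y), X \<union> Y, Y)) (bounded_disjoint_pairs N s r) B"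
  proof (rule bij_betw_byWitness[where f' = "\<lambda>(k, h, H, Y). (H - Y, Y)"])
    show "(\<lambda>(X, Y). (card Y, card (X \<union> Y), X \<union> Y, Y)) ` bounded_disjoint_pairs N s r \<subseteq> B"
    proof clarify
      fix X Y assume "(X, Y) \<in> bounded_disjoint_pairs N s r"
      then have XY: "X \<subseteq> N" "Y \<subseteq> N" "X \<inter> Y = {}" "X \<noteq> {}" "Y \<noteq> {}" "card X \<le> s" "card Y \<le> r"
        by (auto simp: bounded_disjoint_pairs_def)
      have "card (X \<union> Y) = card X + card Y"
        using XY fin by (intro card_Un_disjoint) auto
      moreover have "card X > 0" "card Y > 0"
        using XY fin by (auto simp: card_gt_0_iff)
      ultimately show "(card Y, card (X \<union> Y), X \<union> Y, Y) \<in> B"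
        using XY by (auto simp: B_def)
    qed
    show "(\<lambda>(k, h, H, Y). (H - Y, Y)) ` B \<subseteq> bounded_disjoint_pairs N s r"
    proof clarify
      fix k h H Y assume "(k, h, H, Y) \<in> B"
      then have HY: "1 \<le> card Y" "card Y \<le> r" "card Y + 1 \<le> card H" "card H \<le> card Y + s"
        "H \<subseteq> N" "Y \<subseteq> H"
        by (auto simp: B_def)
      have "card (H - Y) = card H - card Y"
        using HY fin by (intro card_Diff_subset) (auto intro: finite_subset)
      then have "card (H - Y) \<le> s" "card (H - Y) \<noteq> 0"
        using HY by auto
      then show "(H - Y, Y) \<in> bounded_disjoint_pairs N s r"
        using HY by (auto simp: bounded_disjoint_pairs_def)
    qed
  qed (auto simp: bounded_disjoint_pairs_def B_def Un_absorb2)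
  then have "card (bounded_disjoint_pairs N s r) = card B"
    by (rule bij_betw_same_card)
  also have "\<dots> = (\<Sum>k=1..r. \<Sum>h=k+1..k+s. \<Sum>H\<in>{H. H \<subseteq> N \<and> card H = h}. card {Y. Y \<subseteq> H \<and> card Y = k})"
  proof -
    have B: "finite {Y. Y \<subseteq> H \<and> card Y = k}" if "H \<subseteq> N" for H k
      by (rule finite_subset[of _ "Pow H"]) (use fin[OF that] in auto)
    have C: "finite {H. H \<subseteq> N \<and> card H = h}" for h
      by (rule finite_subset[of _ "Pow N"]) (use assms in auto)
    have "card (SIGMA H:{H. H \<subseteq> N \<and> card H = h}. {Y. Y \<subseteq> H \<and> card Y = k}) =
      (\<Sum>H\<in>{H. H \<subseteq> N \<and> card H = h}. card {Y. Y \<subseteq> H \<and> card Y = k})" for h k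
      using B C by (intro card_SigmaI) auto
    moreover have "finite (SIGMA H:{H. H \<subseteq> N \<and> card H = h}. {Y. Y \<subseteq> H \<and> card Y = k})" for h k
      using B C by (intro finite_SigmaI) auto
    ultimately show ?thesis
      unfolding B_def by (subst card_SigmaI; simp add: card_SigmaI finite_SigmaI)
  qed
  also have "\<dots> = (\<Sum>k=1..r. \<Sum>h=k+1..k+s. (card N choose h) * (h choose k))"
    using fin by (intro sum.cong refl) (simp add: n_subsets assms)
  finally show ?thesis .
qed

section \<open>The action of words on the quotients\<close>

lemma left_quotient_append: "left_quotient w (left_quotient v L) = left_quotient (v @ w) L"
  by (simp add: left_quotient_def)

lemma mem_left_quotient: "x \<in> left_quotient w L \<longleftrightarrow> w @ x \<in> L"
  by (simp add: left_quotient_def)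

locale quotient_enumeration =
  fixes L :: "'a list set" and K :: "nat \<Rightarrow> 'a list set" and n :: nat
  assumes bij: "bij_betw K {..<n} (left_quotients L)"
begin

lemma n_pos: "n > 0"
  using bij by (cases "n = 0") (auto simp: bij_betw_def left_quotients_def)

lemma K_quotient: "i < n \<Longrightarrow> \<exists>u. K i = left_quotient u L"
  using bij_betw_apply[OF bij] by (auto simp: left_quotients_def)

lemma quotient_K: "\<exists>i<n. left_quotient u L = K i"
proof -
  have "left_quotient u L \<in> K ` {..<n}"
    unfolding bij_betw_imp_surj_on[OF bij] by (simp add: left_quotients_def)
  then show ?thesis by auto
qed

lemma quotient_of_K:
  assumes "i < n" shows "\<exists>j<n. left_quotient w (K i) = K j"
  using K_quotient[OF assms] quotient_K by (metis left_quotient_append)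

lemma card_left_quotients: "card (left_quotients L) = n" "finite (left_quotients L)"
  using bij bij_betw_same_card[OF bij] bij_betw_finite[OF bij] by auto

text \<open>Values are quotients rather than indices, and the restriction makes equality of actions
  mean agreement on all \<open>K i\<close> with \<open>i < n\<close>. All actions thus lie in a
  \<open>PiE\<close> set of size \<open>n ^ n\<close>.\<close>

definition word_action :: "'a list \<Rightarrow> nat \<Rightarrow> 'a list set" where
  "word_action w = (\<lambda>i\<in>{..<n}. left_quotient w (K i))"

text \<open>As the left context \<open>u\<close> varies, the quotients of \<open>L\<close> by
  \<open>u\<close> run through all the \<open>K i\<close>; the right context \<open>v\<close> tests
  equality of languages.\<close>

lemma syntactic_congruence_iff:
  "(x, y) \<in> syntactic_congruence L \<longleftrightarrow> x \<noteq> [] \<and> y \<noteq> [] \<and> word_action x = word_action y"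
proof -
  have "(\<forall>u v. u @ x @ v \<in> L \<longleftrightarrow> u @ y @ v \<in> L) \<longleftrightarrow>
      (\<forall>u. left_quotient x (left_quotient u L) = left_quotient y (left_quotient u L))"
    by (auto simp: left_quotient_def)
  also have "\<dots> \<longleftrightarrow> (\<forall>i<n. left_quotient x (K i) = left_quotient y (K i))"
    using K_quotient quotient_K by metis
  also have "\<dots> \<longleftrightarrow> word_action x = word_action y"
    by (auto simp: word_action_def fun_eq_iff restrict_def)
  finally show ?thesis
    by (simp add: syntactic_congruence_def)
qed

text \<open>Unlike for atoms, the two index sets need not partition \<open>{..<n}\<close>. This
  makes the family closed under left quotients.\<close>

definition cube :: "nat set \<Rightarrow> nat set \<Rightarrow> 'a list set" where
  "cube X Y = {x. (\<forall>i\<in>X. x \<in> K i) \<and> (\<forall>j\<in>Y. x \<notin> K j)}"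

lemma atomic_intersection_eq_cube: "atomic_intersection K n S = cube S ({..<n} - S)"
  by (auto simp: atomic_intersection_def cube_def)

lemma left_quotient_cube:
  assumes "\<And>i. i \<in> X \<union> Y \<Longrightarrow> left_quotient w (K i) = K (g i)"
  shows "left_quotient w (cube X Y) = cube (g ` X) (g ` Y)"
proof -
  have "w @ x \<in> K i \<longleftrightarrow> x \<in> K (g i)" if "i \<in> X \<union> Y" for x i
    using assms[OF that] by (auto simp: left_quotient_def)
  then show ?thesis
    by (auto simp: mem_left_quotient cube_def)
qed

lemma cube_eq_empty: "X \<inter> Y \<noteq> {} \<Longrightarrow> cube X Y = {}"
  by (auto simp: cube_def)

section \<open>Maximal syntactic complexity: all transformations are induced\<close>

context
  assumes maximal: "syntactic_complexity L = n ^ n"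
begin

lemma transformation_induced:
  assumes "g \<in> {..<n} \<rightarrow> {..<n}"
  shows "\<exists>w. \<forall>i<n. left_quotient w (K i) = K (g i)"
proof -
  let ?A = "{w :: 'a list. w \<noteq> []}"
  let ?E = "{..<n} \<rightarrow>\<^sub>E left_quotients L"
  have sub: "word_action ` ?A \<subseteq> ?E"
    using quotient_of_K bij by (fastforce simp: word_action_def bij_betw_def)
  have fin: "finite ?E"
    by (simp add: finite_PiE card_left_quotients)
  \<comment> \<open>Each congruence class is a fibre of \<open>word_action\<close> on the non-empty
    words, so there are at most as many classes as actions. With \<open>n ^ n\<close> classes, the
    actions must fill \<open>?E\<close>.\<close>
  have "syntactic_semigroup L = (\<lambda>t. {w \<in> ?A. word_action w = t}) ` word_action ` ?A"
  proof -
    have "syntactic_congruence L `` {x} = {w \<in> ?A. word_action w = word_action x}" if "x \<in> ?A" for x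
      using that by (auto simp: syntactic_congruence_iff)
    then show ?thesis
      by (auto simp: syntactic_semigroup_def quotient_def image_image)
  qed
  then have "card (syntactic_semigroup L) \<le> card (word_action ` ?A)"
    using card_image_le[OF finite_subset[OF sub fin]] by (simp only:)
  then have "n ^ n \<le> card (word_action ` ?A)"
    using maximal by (simp add: syntactic_complexity_def)
  moreover have "card ?E = n ^ n"
    by (simp add: card_PiE card_left_quotients)
  ultimately have "word_action ` ?A = ?E"
    using card_seteq[OF fin sub] by simp
  moreover have "(\<lambda>i\<in>{..<n}. K (g i)) \<in> ?E"
    using assms bij by (auto simp: bij_betw_def)
  ultimately obtain w where "(\<lambda>i\<in>{..<n}. K (g i)) = word_action w"
    by blast
  then have "left_quotient w (K i) = K (g i)" if "i < n" for i
    using that by (metis word_action_def restrict_apply' lessThan_iff)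
  then show ?thesis by blast
qed

text \<open>Every word induces some \<open>g\<close> on the indices, as quotients of quotients are
  quotients; conversely every \<open>g\<close> comes from a word by
  \<open>transformation_induced\<close>.\<close>

lemma left_quotients_atomic_intersection:
  assumes "S \<subseteq> {..<n}"
  shows "left_quotients (atomic_intersection K n S) =
    (\<lambda>g. cube (g ` S) (g ` ({..<n} - S))) ` ({..<n} \<rightarrow> {..<n})" (is "_ = ?R")
proof -
  have "left_quotient w (cube S ({..<n} - S)) \<in> ?R" for w
  proof -
    obtain g where g: "\<And>i. i < n \<Longrightarrow> g i < n \<and> left_quotient w (K i) = K (g i)"
      using quotient_of_K[of _ w] by metis
    then have "left_quotient w (cube S ({..<n} - S)) = cube (g ` S) (g ` ({..<n} - S))"
      using assms by (intro left_quotient_cube) auto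
    then show ?thesis using g by auto
  qed
  moreover have "cube (g ` S) (g ` ({..<n} - S)) \<in> range (\<lambda>w. left_quotient w (cube S ({..<n} - S)))"
    if g: "g \<in> {..<n} \<rightarrow> {..<n}" for g
  proof -
    obtain w where "\<forall>i<n. left_quotient w (K i) = K (g i)"
      using transformation_induced[OF g] by blast
    then have "left_quotient w (cube S ({..<n} - S)) = cube (g ` S) (g ` ({..<n} - S))"
      using assms by (intro left_quotient_cube) auto
    then show ?thesis by (metis rangeI)
  qed
  ultimately show ?thesis
    unfolding left_quotients_def atomic_intersection_eq_cube by blast
qed

section \<open>At least two quotients: separating words and the number of atoms\<close>

context
  assumes n_ge_2: "n \<ge> 2"
begin

text \<open>Whether \<open>w\<close> is in \<open>K i\<close> is decided by whether the quotient of
  \<open>K i\<close> by \<open>w\<close> contains the empty word. If all quotients agreed on the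
  empty word, all would be empty or all would be full, contradicting
  \<open>K 0 \<noteq> K 1\<close>.\<close>

lemma ex_K_Nil: "\<exists>a<n. [] \<in> K a" "\<exists>b<n. [] \<notin> K b"
proof -
  have neq: "K 0 \<noteq> K 1"
    using bij n_ge_2 inj_onD[of K "{..<n}" 0 1] by (auto simp: bij_betw_def)
  have *: "w \<in> K i \<longleftrightarrow> [] \<in> left_quotient w (K i)" for w i
    by (simp add: mem_left_quotient)
  show "\<exists>a<n. [] \<in> K a"
  proof (rule ccontr)
    assume "\<not> ?thesis"
    then have "K i = {}" if "i < n" for i
      using * quotient_of_K[OF that] by blast
    then show False using neq n_ge_2 by simp
  qed
  show "\<exists>b<n. [] \<notin> K b"
  proof (rule ccontr)
    assume "\<not> ?thesis"
    then have "K i = UNIV" if "i < n" for i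
      using * quotient_of_K[OF that] by blast
    then show False using neq n_ge_2 by simp
  qed
qed

text \<open>Take a word that sends the indices in \<open>P\<close> to a quotient containing the
  empty word and all others to one that does not.\<close>

lemma ex_word_separating: "\<exists>x. \<forall>i<n. x \<in> K i \<longleftrightarrow> i \<in> P"
proof -
  obtain a b where ab: "a < n" "[] \<in> K a" "b < n" "[] \<notin> K b"
    using ex_K_Nil by blast
  obtain x where "\<forall>i<n. left_quotient x (K i) = K (if i \<in> P then a else b)"
    using transformation_induced[of "\<lambda>i. if i \<in> P then a else b"] ab by auto
  then have "x \<in> K i \<longleftrightarrow> i \<in> P" if "i < n" for i
    using that ab mem_left_quotient[of "[]" x "K i"] by (auto split: if_splits)
  then show ?thesis by blast
qed

lemma atomic_intersection_nonempty: "S \<subseteq> {..<n} \<Longrightarrow> atomic_intersection K n S \<noteq> {}"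
  using ex_word_separating[of S] by (auto simp: atomic_intersection_eq_cube cube_def)

lemma card_atoms: "card (atoms K n) = 2 ^ n"
proof -
  \<comment> \<open>A word that lies in exactly the \<open>K i\<close> with \<open>i \<in> S\<close>
    belongs to the atom of \<open>S\<close> and to no other.\<close>
  have "inj_on (atomic_intersection K n) (Pow {..<n})"
  proof (rule inj_onI)
    fix S T assume "S \<in> Pow {..<n}" "T \<in> Pow {..<n}"
      and eq: "atomic_intersection K n S = atomic_intersection K n T"
    moreover obtain x where "\<forall>i<n. x \<in> K i \<longleftrightarrow> i \<in> S"
      using ex_word_separating by blast
    moreover from calculation have "x \<in> atomic_intersection K n T"
      unfolding eq[symmetric] by (auto simp: atomic_intersection_eq_cube cube_def)
    ultimately show "S = T"
      by (auto simp: atomic_intersection_eq_cube cube_def)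
  qed
  moreover have "atoms K n = atomic_intersection K n ` Pow {..<n}"
    using atomic_intersection_nonempty by (auto simp: atoms_def)
  ultimately show ?thesis
    by (simp add: card_image card_Pow)
qed

text \<open>The words whose sets of indices are \<open>X\<close> and \<open>{..<n} - Y\<close> both lie in \<open>cube X Y\<close>.\<close>

lemma cube_subset:
  assumes sub: "cube X Y \<subseteq> cube X' Y'" and disj: "X \<inter> Y = {}"
    and "X \<subseteq> {..<n}" "Y \<subseteq> {..<n}" "X' \<subseteq> {..<n}" "Y' \<subseteq> {..<n}"
  shows "X' \<subseteq> X" "Y' \<subseteq> Y"
proof -
  obtain x y where xy: "\<forall>i<n. x \<in> K i \<longleftrightarrow> i \<in> X" "\<forall>i<n. y \<in> K i \<longleftrightarrow> i \<in> - Y"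
    using ex_word_separating by metis
  then have "x \<in> cube X Y" "y \<in> cube X Y"
    using assms(2-4) by (auto simp: cube_def)
  then have "x \<in> cube X' Y'" "y \<in> cube X' Y'"
    using sub by auto
  then have "\<forall>i\<in>X'. x \<in> K i" "\<forall>j\<in>Y'. y \<notin> K j"
    by (auto simp: cube_def)
  then show "X' \<subseteq> X" "Y' \<subseteq> Y"
    using xy assms(5,6) by blast+
qed

lemma cube_inject:
  assumes "cube X Y = cube X' Y'" "X \<inter> Y = {}" "X' \<inter> Y' = {}"
    and "X \<subseteq> {..<n}" "Y \<subseteq> {..<n}" "X' \<subseteq> {..<n}" "Y' \<subseteq> {..<n}"
  shows "X = X' \<and> Y = Y'"
  using cube_subset[of X Y X' Y'] cube_subset[of X' Y' X Y] assms by auto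

lemma cube_nonempty:
  assumes "X \<inter> Y = {}" "X \<subseteq> {..<n}" "Y \<subseteq> {..<n}"
  shows "cube X Y \<noteq> {}"
proof -
  obtain x where "\<forall>i<n. x \<in> K i \<longleftrightarrow> i \<in> X"
    using ex_word_separating by blast
  then have "x \<in> cube X Y"
    using assms by (auto simp: cube_def)
  then show ?thesis by blast
qed

section \<open>Quotient complexity of the atoms\<close>

lemma images_of_transformations:
  "(\<lambda>g. g ` {..<n}) ` ({..<n} \<rightarrow> {..<n}) = Pow {..<n} - {{}}"
proof -
  have "X \<in> (\<lambda>g. g ` {..<n}) ` ({..<n} \<rightarrow> {..<n})" if X: "X \<subseteq> {..<n}" "X \<noteq> {}" for X
  proof -
    have "finite X" "card X \<le> card {..<n}"
      using X card_mono[of "{..<n}" X] by (auto intro: finite_subset)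
    then obtain g where "g ` {..<n} = X"
      using ex_image_eq_if_card_le[of "{..<n}" X] X(2) by auto
    then show ?thesis using X by blast
  qed
  then show ?thesis using n_pos by auto
qed

lemma quotient_complexity_extremal:
  assumes "S = {} \<or> S = {..<n}"
  shows "quotient_complexity (atomic_intersection K n S) = 2 ^ n - 1"
proof -
  \<comment> \<open>One of the two index sets is empty and stays empty under \<open>g\<close>; the
    other is all of \<open>{..<n}\<close>, so a quotient depends only on the image of
    \<open>g\<close>.\<close>
  define f where "f = (\<lambda>X. if S = {} then cube {} X else cube X {})"
  have "left_quotients (atomic_intersection K n S) = f ` (\<lambda>g. g ` {..<n}) ` ({..<n} \<rightarrow> {..<n})"
    using assms by (subst left_quotients_atomic_intersection) (auto simp: f_def image_image)
  also have "\<dots> = f ` (Pow {..<n} - {{}})"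
    unfolding images_of_transformations ..
  finally have "left_quotients (atomic_intersection K n S) = f ` (Pow {..<n} - {{}})" .
  moreover have "inj_on f (Pow {..<n} - {{}})"
    by (auto simp: f_def inj_on_def dest: cube_inject)
  ultimately show ?thesis
    by (simp add: quotient_complexity_def card_image card_Pow card_Diff_subset)
qed

text \<open>The summand 1 is the empty quotient, which arises when the two images meet; disjoint
  images give non-empty, pairwise distinct cubes.\<close>

lemma quotient_complexity_proper:
  assumes S: "S \<subseteq> {..<n}" "S \<noteq> {}" "S \<noteq> {..<n}" and r: "r = card ({..<n} - S)"
  shows "quotient_complexity (atomic_intersection K n S) =
    1 + card (bounded_disjoint_pairs {..<n} (card S) r)"
proof -
  let ?D = "bounded_disjoint_pairs {..<n} (card S) r"
  let ?f = "\<lambda>g. cube (g ` S) (g ` ({..<n} - S))"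
  have fin: "finite S"
    using S finite_subset by blast
  have D: "?f g \<in> insert {} (case_prod cube ` ?D)" if "g \<in> {..<n} \<rightarrow> {..<n}" for g
  proof (cases "g ` S \<inter> g ` ({..<n} - S) = {}")
    case True
    moreover have "card (g ` S) \<le> card S" "card (g ` ({..<n} - S)) \<le> r"
      using fin r by (auto intro: card_image_le)
    moreover have "g ` S \<subseteq> {..<n}" "g ` ({..<n} - S) \<subseteq> {..<n}" "g ` S \<noteq> {}" "g ` ({..<n} - S) \<noteq> {}"
      using that S by auto
    ultimately have "(g ` S, g ` ({..<n} - S)) \<in> ?D"
      by (simp add: bounded_disjoint_pairs_def)
    then show ?thesis by force
  qed (simp add: cube_eq_empty)
  \<comment> \<open>Both \<open>S\<close> and its complement are non-empty, so a constant map makes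
    their images meet.\<close>
  have "?f (\<lambda>_. 0) = {}"
    using S by (intro cube_eq_empty) auto
  moreover have "(\<lambda>_. 0) \<in> {..<n} \<rightarrow> {..<n}"
    using n_pos by simp
  ultimately have E: "{} \<in> ?f ` ({..<n} \<rightarrow> {..<n})"
    by (metis (mono_tags, lifting) image_eqI)
  have F: "cube X Y \<in> ?f ` ({..<n} \<rightarrow> {..<n})" if XY: "(X, Y) \<in> ?D" for X Y
  proof -
    obtain g where "g \<in> {..<n} \<rightarrow> {..<n}" "g ` S = X" "g ` ({..<n} - S) = Y"
      using ex_map_with_two_images[of "{..<n}" S X Y] XY S(1) finite_lessThan[of n]
      unfolding r bounded_disjoint_pairs_def by blast
    then show ?thesis by blast
  qed
  have "left_quotients (atomic_intersection K n S) = insert {} (case_prod cube ` ?D)"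
    unfolding left_quotients_atomic_intersection[OF S(1)]
  proof (rule equalityI)
    show "?f ` ({..<n} \<rightarrow> {..<n}) \<subseteq> insert {} (case_prod cube ` ?D)"
      by (rule image_subsetI) (rule D)
    show "insert {} (case_prod cube ` ?D) \<subseteq> ?f ` ({..<n} \<rightarrow> {..<n})"
      by (intro insert_subsetI E image_subsetI) (simp only: split_paired_all case_prod_conv F)
  qed
  moreover have "inj_on (case_prod cube) ?D"
  proof (rule inj_onI, clarify)
    fix X Y X' Y' assume "(X, Y) \<in> ?D" "(X', Y') \<in> ?D" "cube X Y = cube X' Y'"
    then show "X = X' \<and> Y = Y'"
      by (intro cube_inject) (simp_all add: bounded_disjoint_pairs_def)
  qed
  moreover have "{} \<notin> case_prod cube ` ?D"
  proof clarify
    fix X Y assume "(X, Y) \<in> ?D" "{} = cube X Y"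
    then show False
      using cube_nonempty[of X Y] by (simp add: bounded_disjoint_pairs_def)
  qed
  moreover have "finite ?D"
    by (rule finite_subset[of _ "Pow {..<n} \<times> Pow {..<n}"])
      (auto simp: bounded_disjoint_pairs_def)
  ultimately show ?thesis
    by (simp add: quotient_complexity_def card_image)
qed

end

text \<open>The only transformation of a single index is the identity, so the language is its own
  only quotient.\<close>

lemma quotient_complexity_one:
  assumes "n = 1" "S \<subseteq> {..<n}"
  shows "quotient_complexity (atomic_intersection K n S) = 1"
proof -
  have "g ` T = T" if "g \<in> {..<n} \<rightarrow> {..<n}" "T \<subseteq> {..<n}" for g T
    using that assms(1) by (force simp: subset_eq image_iff)
  then have "left_quotients (atomic_intersection K n S) =
      (\<lambda>_. cube S ({..<n} - S)) ` ({..<n} \<rightarrow> {..<n})"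
    unfolding left_quotients_atomic_intersection[OF assms(2)] using assms(2)
    by (intro image_cong) auto
  moreover have "id \<in> {..<n} \<rightarrow> {..<n}" by simp
  ultimately have "left_quotients (atomic_intersection K n S) = {cube S ({..<n} - S)}"
    by blast
  then show ?thesis
    by (simp add: quotient_complexity_def)
qed

end

end

theorem theorem1:
  fixes L :: "'a::finite list set" and K :: "nat \<Rightarrow> 'a list set" and n :: nat
  assumes "regular_language L"
    and "bij_betw K {..<n} (left_quotients L)"
    and "syntactic_complexity L = n ^ n"
  shows "(n \<ge> 2 \<longrightarrow> card (atoms K n) = 2 ^ n) \<and>
    (\<forall>S r. S \<subseteq> {..<n} \<and> atomic_intersection K n S \<noteq> {} \<and> r = card ({..<n} - S) \<longrightarrow>
       quotient_complexity (atomic_intersection K n S) =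
         (if r = 0 \<or> r = n then 2 ^ n - 1
          else 1 + (\<Sum>k=1..r. \<Sum>h=k+1..k+n-r. (n choose h) * (h choose k))))"
proof -
  interpret quotient_enumeration L K n
    by unfold_locales (rule assms(2))
  note max = assms(3)
  have "quotient_complexity (atomic_intersection K n S) =
         (if r = 0 \<or> r = n then 2 ^ n - 1
          else 1 + (\<Sum>k=1..r. \<Sum>h=k+1..k+n-r. (n choose h) * (h choose k)))"
    if S: "S \<subseteq> {..<n}" and r: "r = card ({..<n} - S)" for S r
  proof -
    have fin: "finite S"
      using S finite_subset by blast
    have card_S: "card S \<le> n"
      using card_mono[OF _ S] by simp
    have r': "r = n - card S"
      using r S fin by (simp add: card_Diff_subset)
    have r_extremal: "r = 0 \<or> r = n \<longleftrightarrow> S = {} \<or> S = {..<n}"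
      using r' card_S n_pos card_subset_eq[OF _ S] card_eq_0_iff[of S] fin by fastforce
    \<comment> \<open>Separating words require two distinct quotients. For \<open>n = 1\<close>
      always \<open>r = 0 \<or> r = n\<close>, and the value is
      \<open>2 ^ 1 - 1 = 1\<close>.\<close>
    consider "n = 1" | "n \<ge> 2" "S = {} \<or> S = {..<n}" | "n \<ge> 2" "S \<noteq> {}" "S \<noteq> {..<n}"
      using n_pos by linarith
    then show ?thesis
    proof cases
      case 1
      then have "r = 0 \<or> r = n"
        using r' card_S by auto
      then show ?thesis
        using quotient_complexity_one[OF max 1 S] 1 by simp
    next
      case 2
      then show ?thesis
        using r_extremal quotient_complexity_extremal[OF max] by simp
    next
      case 3
      \<comment> \<open>The subtraction on naturals is not truncated, since
        \<open>r = n - card S\<close> and \<open>card S \<le> n\<close>; so the upper limits of the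
        inner sums agree.\<close>
      have "k + card S = k + n - r" for k
        using r' card_S by simp
      then show ?thesis
        using 3 r_extremal quotient_complexity_proper[OF max 3(1) S 3(2,3) r]
          card_bounded_disjoint_pairs[of "{..<n}" "card S" r] by simp
    qed
  qed
  then show ?thesis
    using card_atoms[OF max] by blast
qed

end
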